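(* Let $p,n$ be positive integers with $p\ge n\ge 5$. Let $r\in\{0,1,\ldots,n-2\}$ be given by $p\equiv r \pmod{n-1}$. Then $$ex(p;T_n)=\begin{cases}\left\lfloor\frac{(n-2)(p-1)-r-1}{2}\right\rfloor & \text{if } n\ge 7 \text{ and } 2\le r\le n-4,\\[4pt] \frac{(n-2)p-r(n-1-r)}{2} & \text{otherwise.}\end{cases}$$
   Context: All graphs are finite simple graphs. For $n\ge 5$, $T_n$ denotes the unique (up to isomorphism) tree on $n$ vertices with maximal degree $n-2$. For a graph $L$, $ex(p;L)$ denotes the maximal number of edges in a graph on $p$ vertices that does not contain $L$ as a (not necessarily induced) subgraph. *)

theory Defs
  imports "Graph_Theory.Graph_Theory" "HOL-Number_Theory.Cong"
begin

text \<open>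
  A finite simple graph is a \<open>pair_graph\<close>: finitely many vertices and a symmetric irreflexive arc
  relation, so that each undirected edge occurs as two opposite arcs.
\<close>

definition edges :: "'a pair_pre_digraph \<Rightarrow> 'a set set" where
  "edges G = {{u, v} | u v. (u, v) \<in> parcs G}"

text \<open>In a symmetric digraph the out-degree of a vertex is its degree as an undirected graph.\<close>

definition max_degree :: "'a pair_pre_digraph \<Rightarrow> nat" where
  "max_degree G = Max (out_degree (with_proj G) ` pverts G)"

text \<open>
  The library constant \<open>tree\<close> cannot be used here: it also forbids the closed walk \<open>u, v, u\<close>, hence
  every symmetric digraph with an arc. In a \<open>pair_graph\<close> the undirected cycles are exactly the
  library's cycles of length at least 3.
\<close>

definition simple_tree :: "'a pair_pre_digraph \<Rightarrow> bool" where
  "simple_tree G \<longleftrightarrow> pair_graph G \<and> connected (with_proj G) \<and>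
     (\<nexists>c. pre_digraph.cycle (with_proj G) c \<and> 3 \<le> length c)"

text \<open>\<open>is_T n\<close> describes $T_n$ up to isomorphism, for $n \ge 5$.\<close>

definition is_T :: "nat \<Rightarrow> 'a pair_pre_digraph \<Rightarrow> bool" where
  "is_T n T \<longleftrightarrow> simple_tree T \<and> card (pverts T) = n \<and> max_degree T = n - 2"

text \<open>Such a tree exists: a star with centre 0 and leaves \<open>1, \<dots>, n - 2\<close>, plus the edge from 1 to \<open>n - 1\<close>.\<close>

lemma is_T_exists:
  assumes n: "n \<ge> 5"
  shows "\<exists>T :: nat pair_pre_digraph. is_T n T"
proof -
  define A where "A = {(u, v). (u = 0 \<and> 1 \<le> v \<and> v \<le> n - 2) \<or> (v = 0 \<and> 1 \<le> u \<and> u \<le> n - 2)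
      \<or> (u = 1 \<and> v = n - 1) \<or> (u = n - 1 \<and> v = 1)}"
  define T where "T = \<lparr>pverts = {0..<n}, parcs = A\<rparr>"
  have A_sub: "A \<subseteq> {0..<n} \<times> {0..<n}" using n by (auto simp: A_def)
  then have fin: "finite A" by (rule finite_subset) auto
  have sym: "sym A" by (auto simp: A_def sym_def)
  have A_E: "fst e < n" "snd e < n" "fst e \<noteq> snd e" if "e \<in> A" for e
    using that n by (auto simp: A_def)
  interpret T: pair_graph T
  proof unfold_locales
    show "symmetric (with_proj T)" using sym by (simp add: symmetric_def T_def)
  qed (use A_E fin in \<open>simp_all add: T_def\<close>)

  have out: "out_arcs (with_proj T) x = {e \<in> A. fst e = x}" for x
    by (auto simp: out_arcs_def T_def)
  have deg0: "out_degree (with_proj T) 0 = n - 2"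
  proof -
    have "{e \<in> A. fst e = 0} = Pair 0 ` {1..n - 2}" using n by (auto simp: A_def)
    then show ?thesis by (simp add: out_degree_def out card_image inj_on_def)
  qed
  have deg: "out_degree (with_proj T) x \<le> n - 2" if "x \<noteq> 0" for x
  proof -
    have "{e \<in> A. fst e = x} \<subseteq> {(x, 0), (x, n - 1), (x, 1)}"
      using that by (auto simp: A_def)
    then have "card {e \<in> A. fst e = x} \<le> card {(x, 0), (x, n - 1), (x, 1)}"
      by (intro card_mono) auto
    also have "\<dots> \<le> 3" by (auto simp: card_insert_if)
    finally show ?thesis using n by (simp add: out_degree_def out)
  qed
  have maxd: "max_degree T = n - 2"
    unfolding max_degree_def
  proof (rule Max_eqI)
    show "n - 2 \<in> out_degree (with_proj T) ` pverts T"
      using deg0 n by (auto simp: T_def image_iff intro!: bexI[of _ 0])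
  next
    fix y assume "y \<in> out_degree (with_proj T) ` pverts T"
    then obtain x where "y = out_degree (with_proj T) x" by blast
    then show "y \<le> n - 2" using deg[of x] deg0 by (cases "x = 0") auto
  qed (simp add: T_def)

  have S_eq: "mk_symmetric (with_proj T) = T"
    using sym by (auto simp: mk_symmetric_def T_def sym_def)
  have wfT: "wf_digraph (with_proj T)" by unfold_locales
  have symT: "symmetric (with_proj T)" using sym by (simp add: symmetric_def T_def)
  have to0: "x \<rightarrow>\<^sup>*\<^bsub>with_proj T\<^esub> 0" if "x < n" for x
  proof -
    have adj: "y \<rightarrow>\<^sup>*\<^bsub>with_proj T\<^esub> z" if "(y, z) \<in> A" for y z
      by (rule wf_digraph.reachable_adjI[OF wfT]) (use that in \<open>simp add: T_def\<close>)
    consider "x = 0" | "1 \<le> x" "x \<le> n - 2" | "x = n - 1" using \<open>x < n\<close> by linarith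
    then show ?thesis
    proof cases
      case 1 then show ?thesis using wf_digraph.reachable_refl[OF wfT, of 0] n by (simp add: T_def)
    next
      case 2 then show ?thesis by (intro adj) (auto simp: A_def)
    next
      case 3
      have "x \<rightarrow>\<^sup>*\<^bsub>with_proj T\<^esub> 1" "1 \<rightarrow>\<^sup>*\<^bsub>with_proj T\<^esub> 0"
        using 3 n by (auto intro!: adj simp: A_def)
      then show ?thesis by (rule wf_digraph.reachable_trans[OF wfT])
    qed
  qed
  have conn: "connected (with_proj T)"
    unfolding connected_def S_eq
  proof (rule strongly_connectedI)
    show "verts (with_proj T) \<noteq> {}" using n by (simp add: T_def)
    fix u v assume "u \<in> verts (with_proj T)" "v \<in> verts (with_proj T)"
    then have "u \<rightarrow>\<^sup>*\<^bsub>with_proj T\<^esub> 0" "0 \<rightarrow>\<^sup>*\<^bsub>with_proj T\<^esub> v"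
      using to0 symmetric_reachable[OF symT] by (auto simp: T_def)
    then show "u \<rightarrow>\<^sup>*\<^bsub>with_proj T\<^esub> v" by (rule wf_digraph.reachable_trans[OF wfT])
  qed

  have steps: "pcas u p v \<Longrightarrow> i < length p \<Longrightarrow>
      snd (p ! i) = (if Suc i < length p then fst (p ! Suc i) else v)" for u v i and p :: "(nat \<times> nat) list"
  proof (induction p arbitrary: u i)
    case (Cons e es)
    then show ?case by (cases i; cases es) auto
  qed simp
  have tlv: "pcas u p v \<Longrightarrow> pawalk_verts u p = u # map snd p" for u v and p :: "(nat \<times> nat) list"
    by (induction p arbitrary: u) auto

  have no_cycle: False if cyc: "pre_digraph.cycle (with_proj T) p" and len: "3 \<le> length p" for p
  proof -
    obtain u where w: "pcas u p u" "set p \<subseteq> A" "distinct (tl (pawalk_verts u p))"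
      using cyc by (auto simp: pre_digraph.cycle_def pre_digraph.awalk_def T_def
          cas_with_proj_eq awalk_verts_with_proj_eq)
    let ?m = "length p"
    have dist: "distinct (map snd p)" using w tlv[of u p u] by simp
    have nxt: "snd (p ! i) = fst (p ! (Suc i mod ?m))" if "i < ?m" for i
    proof (cases "Suc i < ?m")
      case True then show ?thesis using steps[OF w(1) that] by simp
    next
      case False
      then have "Suc i = ?m" using that by simp
      moreover have "fst (p ! 0) = u" using w(1) len by (cases p) auto
      ultimately show ?thesis using steps[OF w(1) that] by simp
    qed
    have in01: "snd (p ! i) \<in> {0, 1}" if i: "i < ?m" for i
    proof (rule ccontr)
      assume leaf: "snd (p ! i) \<notin> {0, 1}"
      define h where "h = (if i = 0 then ?m - 1 else i - 1)"
      define j where "j = Suc i mod ?m"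
      have h: "h < ?m" "Suc h mod ?m = i" and j: "j < ?m" "h \<noteq> j"
        using i len by (auto simp: h_def j_def mod_Suc)
      have "p ! i \<in> A" "p ! j \<in> A" using w(2) i j by auto
      moreover have "snd (p ! i) = fst (p ! j)" using nxt[OF i] by (simp add: j_def)
      ultimately have "fst (p ! i) = snd (p ! j)"
        using leaf n by (cases "p ! i"; cases "p ! j") (auto simp: A_def)
      moreover have "snd (p ! h) = fst (p ! i)" using nxt[OF h(1)] h(2) by simp
      ultimately have "map snd p ! h = map snd p ! j" using h j by simp
      then show False using nth_eq_iff_index_eq[OF dist, of h j] h j by simp
    qed
    have "set (map snd p) \<subseteq> {0, 1}" using in01 by (force simp: in_set_conv_nth)
    then have "card (set (map snd p)) \<le> card {0 :: nat, 1}" by (intro card_mono) auto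
    then show False using distinct_card[OF dist] len by simp
  qed

  have "is_T n T"
    using maxd conn no_cycle T.pair_graph_axioms by (auto simp: is_T_def simple_tree_def T_def)
  then show ?thesis by blast
qed

definition contains_subgraph :: "'a pair_pre_digraph \<Rightarrow> 'b pair_pre_digraph \<Rightarrow> bool" where
  "contains_subgraph G L \<longleftrightarrow> (\<exists>H. subgraph H (with_proj G) \<and> digraph_iso (with_proj L) H)"

text \<open>
  Every finite graph has an isomorphic copy with natural numbers as vertices, so restricting the
  vertex type of \<open>G\<close> loses nothing.
\<close>

definition ex :: "nat \<Rightarrow> 'a pair_pre_digraph \<Rightarrow> nat" where
  "ex p L = Max {card (edges G) | G :: nat pair_pre_digraph.
     pair_graph G \<and> card (pverts G) = p \<and> \<not> contains_subgraph G L}"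

end

theory Submission imports Defs begin

text \<open>
  If a vertex $v$ of a $T_n$-free graph has degree at least $n-2$, then its closed neighbourhood is
  a connected component: a subgraph of $K_{n-1}$ when $\deg v = n-2$, and a star when
  $\deg v \ge n-1$. Every other component has maximal degree at most $n-3$, and since $n \ge 5$ a star
  also has average degree at most $n-3$. So if $j$ components have $n-1$ vertices and a vertex of
  degree $n-2$, and $q$ vertices remain, then twice the number of edges is at most
  $j(n-1)(n-2) + \min(q(q-1), (n-3)q)$. Write $p = k(n-1)+r$. The case $j = k$ is attained by
  $k K_{n-1} \cup K_r$ and the case $j < k$ by $(k-1)K_{n-1}$ together with a graph on $n-1+r$ vertices
  that is $(n-3)$-regular up to parity. The latter has at least as many edges when
  $r(n-2-r) \ge n-1$, which holds if $n \ge 7$ and $2 \le r \le n-4$, and never more otherwise.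
\<close>

section \<open>Arc sets, degrees and the local form of $T_n$-freeness\<close>

text \<open>
  Graphs are handled through their symmetric arc sets, so \<open>card P\<close> is twice the number of edges.
\<close>

definition graph_on :: "'a set \<Rightarrow> 'a rel \<Rightarrow> bool" where
  "graph_on V P \<longleftrightarrow> P \<subseteq> V \<times> V \<and> sym P \<and> irrefl P"

text \<open>
  The vertices \<open>v\<close>, \<open>u\<close>, \<open>w\<close> are the candidates for the centre of $T_n$, its neighbour of degree 2, and
  the leaf at distance 2 from the centre.
\<close>

definition T_free :: "nat \<Rightarrow> 'a rel \<Rightarrow> bool" where
  "T_free n P \<longleftrightarrow>
     (\<forall>v u w. (v, u) \<in> P \<longrightarrow> (u, w) \<in> P \<longrightarrow> w \<noteq> v \<longrightarrow> card (P `` {v} - {u, w}) < n - 3)"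

lemma finite_graph_on: "graph_on V P \<Longrightarrow> finite V \<Longrightarrow> finite P"
  by (auto simp: graph_on_def dest: finite_subset)

lemma card_eq_sum_degrees:
  assumes "finite V" "P \<subseteq> V \<times> V"
  shows "card P = (\<Sum>v\<in>V. card (P `` {v}))"
proof -
  have "P = (SIGMA v:V. P `` {v})" using assms by auto
  moreover have "\<forall>v\<in>V. finite (P `` {v})"
    using assms by (auto intro!: finite_Image dest: finite_subset)
  ultimately show ?thesis using assms(1) card_SigmaI by metis
qed

lemma card_off_diagonal:
  assumes "finite V"
  shows "card (V \<times> V - Id) = card V * (card V - 1)"
proof -
  have "card (V \<times> V - Id) = (\<Sum>v\<in>V. card ((V \<times> V - Id) `` {v}))"
    using assms by (intro card_eq_sum_degrees) auto
  also have "\<dots> = (\<Sum>v\<in>V. card V - 1)"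
  proof (rule sum.cong)
    fix v assume "v \<in> V"
    then have "(V \<times> V - Id) `` {v} = V - {v}" by auto
    then show "card ((V \<times> V - Id) `` {v}) = card V - 1" using \<open>v \<in> V\<close> assms by simp
  qed simp
  finally show ?thesis by simp
qed

lemma card_graph_on_le:
  assumes "finite V" "graph_on V P"
  shows "card P \<le> card V * (card V - 1)"
proof -
  have "card P \<le> card (V \<times> V - Id)"
    using assms by (intro card_mono) (auto simp: graph_on_def irrefl_def)
  then show ?thesis using card_off_diagonal[OF assms(1)] by simp
qed

lemma T_free_mono:
  assumes "T_free n P" "Q \<subseteq> P" "finite P"
  shows "T_free n Q"
  unfolding T_free_def
proof (intro allI impI)
  fix v u w assume *: "(v, u) \<in> Q" "(u, w) \<in> Q" "w \<noteq> v"
  have "card (Q `` {v} - {u, w}) \<le> card (P `` {v} - {u, w})"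
    using assms(2,3) by (intro card_mono) (auto intro: finite_Image)
  then show "card (Q `` {v} - {u, w}) < n - 3"
    using assms * unfolding T_free_def by (meson le_less_trans subsetD)
qed

text \<open>The centre \<open>v\<close> has at most \<open>n - 3\<close> neighbours and
  \<open>u\<close> is one of them, so fewer than \<open>n - 3\<close> remain once \<open>u\<close>
  is removed.\<close>

lemma T_free_if_degree_le:
  assumes "finite P" and "n \<ge> 4" and deg: "\<And>v. card (P `` {v}) \<le> n - 3"
  shows "T_free n P"
  unfolding T_free_def
proof (intro allI impI)
  fix v u w assume *: "(v, u) \<in> P"
  have "card (P `` {v} - {u, w}) < card (P `` {v})"
    using assms(1) * by (intro psubset_card_mono) (auto intro: finite_Image)
  then show "card (P `` {v} - {u, w}) < n - 3" using deg[of v] by simp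
qed

section \<open>Upper bound by splitting off components\<close>

text \<open>Induction on \<open>V\<close>, removing the closed neighbourhood of a vertex of degree
  above \<open>n - 3\<close>, which is a whole component. \<open>j\<close> counts the removed
  components with \<open>n - 1\<close> vertices; all other vertices, those of stars included, go
  into \<open>q\<close>. Both bounds are carried for the same \<open>j\<close> and \<open>q\<close>,
  since which one is useful depends on \<open>j\<close>.\<close>

lemma T_free_card_bound:
  assumes "finite V" "graph_on V P" "T_free n P" and n: "n \<ge> 5"
  shows "\<exists>j q. card V = j * (n - 1) + q \<and>
     card P \<le> j * ((n - 1) * (n - 2)) + q * (q - 1) \<and>
     card P \<le> j * ((n - 1) * (n - 2)) + (n - 3) * q"
  using assms(1-3)
proof (induction V arbitrary: P rule: finite_psubset_induct)
  case (psubset V)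
  have sub: "P \<subseteq> V \<times> V" and sy: "sym P" and ir: "irrefl P"
    using psubset.prems by (auto simp: graph_on_def)
  have finP: "finite P" using psubset by (simp add: finite_graph_on)
  have finN: "finite (P `` {x})" for x using finP by (rule finite_Image)
  show ?case
  proof (cases "\<forall>v\<in>V. card (P `` {v}) \<le> n - 3")
    case True
    have "card P = (\<Sum>v\<in>V. card (P `` {v}))" using psubset sub by (intro card_eq_sum_degrees)
    also have "\<dots> \<le> (n - 3) * card V" using sum_bounded_above[of V _ "n - 3"] True
      by (simp add: mult.commute)
    finally have "card P \<le> (n - 3) * card V" .
    then show ?thesis using card_graph_on_le[OF psubset.hyps psubset.prems(1)]
      by (intro exI[of _ 0] exI[of _ "card V"]) simp
  next
    case False
    then obtain v where v: "v \<in> V" "card (P `` {v}) > n - 3" by force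
    define N where "N = P `` {v}"
    define W where "W = insert v N"
    define Q where "Q = P \<inter> (V - W) \<times> (V - W)"
    have vN: "v \<notin> N" using ir by (auto simp: N_def irrefl_def)
    have finNN: "finite N" using finN by (simp add: N_def)
    have cN: "card N \<ge> n - 2" using v n by (simp add: N_def)
    have pat: "card (N - {u, w}) < n - 3" if "u \<in> N" "(u, w) \<in> P" "w \<noteq> v" for u w
      using psubset.prems(2) that unfolding T_free_def N_def by auto
    \<comment> \<open>No arc leaves \<open>W\<close>: it would start at some \<open>u\<close> in
      \<open>N\<close> and end outside \<open>N\<close>, so only \<open>u\<close> is removed from
      \<open>N\<close> and at least \<open>n - 3\<close> vertices remain, against
      \<open>pat\<close>.\<close>
    have closed: "w \<in> W" if "(u, w) \<in> P" "u \<in> W" for u w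
    proof (rule ccontr)
      assume w: "w \<notin> W"
      then have u: "u \<in> N" using that by (auto simp: W_def N_def)
      have "N - {u, w} = N - {u}" using w by (auto simp: W_def)
      then have "card (N - {u, w}) = card N - 1" using u finNN by simp
      then show False using pat[OF u that(1)] w cN by (auto simp: W_def)
    qed
    have WV: "W \<subseteq> V" using v sub by (auto simp: W_def N_def)
    have split: "P = (P \<inter> W \<times> W) \<union> Q"
    proof -
      have "b \<in> W \<longleftrightarrow> a \<in> W" if "(a, b) \<in> P" for a b
        using closed that symD[OF sy that] by blast
      then show ?thesis using sub by (auto simp: Q_def)
    qed
    have "card P \<le> card (P \<inter> W \<times> W) + card Q"
      by (subst split) (rule card_Un_le)
    have "graph_on (V - W) Q" using psubset.prems(1) by (auto simp: graph_on_def Q_def sym_def irrefl_def)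
    moreover have "T_free n Q" 
      by (rule T_free_mono[OF psubset.prems(2) _ finP]) (auto simp: Q_def)
    moreover have "V - W \<subset> V" using v by (auto simp: W_def)
    ultimately obtain j q where jq: "card (V - W) = j * (n - 1) + q"
      "card Q \<le> j * ((n - 1) * (n - 2)) + q * (q - 1)"
      "card Q \<le> j * ((n - 1) * (n - 2)) + (n - 3) * q"
      using psubset.IH by meson
    have finW: "finite W" using finNN by (simp add: W_def)
    have cW: "card W = Suc (card N)" using finNN vN by (simp add: W_def)
    have cV: "card V = card (V - W) + card W"
      using WV psubset.hyps finW by (simp add: card_Diff_subset card_mono)
    show ?thesis
    proof (cases "card N = n - 2")
      case True
      then have "card W = n - 1" using cW n by simp
      moreover have "graph_on W (P \<inter> W \<times> W)"
        using sy ir by (auto simp: graph_on_def sym_def irrefl_def)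
      ultimately have "card (P \<inter> W \<times> W) \<le> (n - 1) * (n - 1 - 1)"
        using card_graph_on_le[OF finW] by metis
      then have "card (P \<inter> W \<times> W) \<le> (n - 1) * (n - 2)" by (simp add: numeral_2_eq_2)
      then show ?thesis
        using jq \<open>card P \<le> _\<close> cV \<open>card W = n - 1\<close>
        by (intro exI[of _ "Suc j"] exI[of _ q]) auto
    next
      case False
      then have D: "card N \<ge> n - 1" using cN by simp
      \<comment> \<open>With \<open>n - 1\<close> neighbours of \<open>v\<close>, even an edge
        inside \<open>N\<close> leaves \<open>n - 3\<close> further leaves. Hence \<open>N\<close>
        is independent and \<open>W\<close> is a star centred at \<open>v\<close>.\<close>
      have "w = v" if "u \<in> N" "(u, w) \<in> P" for u w
      proof (rule ccontr)
        assume "w \<noteq> v"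
        have "card N - card {u, w} \<le> card (N - {u, w})" by (intro diff_card_le_card_Diff) simp
        moreover have "card {u, w} \<le> 2" by (simp add: card_insert_if)
        ultimately show False using pat[OF that \<open>w \<noteq> v\<close>] D by simp
      qed
      then have "P \<inter> W \<times> W \<subseteq> {v} \<times> N \<union> N \<times> {v}" by (auto simp: W_def N_def)
      then have "card (P \<inter> W \<times> W) \<le> card ({v} \<times> N \<union> N \<times> {v})"
        using finNN by (intro card_mono) auto
      also have "\<dots> \<le> 2 * card N"
        using card_Un_le[of "{v} \<times> N" "N \<times> {v}"] by (simp add: card_cartesian_product)
      finally have star: "card P \<le> card Q + 2 * card N" using \<open>card P \<le> _\<close> by simp
      define D where "D = card N"
      have D2: "D \<ge> 2" using cN n by (simp add: D_def)
      \<comment> \<open>The star adds \<open>D + 1\<close> vertices to \<open>q\<close> and at most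
        \<open>2 * D\<close> arcs. Both bounds absorb these because \<open>D\<close> and
        \<open>n - 3\<close> are at least 2.\<close>
      have "q * (q - 1) + 2 * D \<le> (q + Suc D) * (q + Suc D - 1)"
      proof -
        have "q * (q - 1) \<le> q * (q + D)" by (intro mult_le_mono) auto
        moreover have "2 * D \<le> Suc D * (q + D)" using D2 by (intro mult_le_mono) auto
        moreover have "q + Suc D - 1 = q + D" by simp
        ultimately show ?thesis by (simp only: add_mult_distrib add_mono)
      qed
      moreover have "(n - 3) * q + 2 * D \<le> (n - 3) * (q + Suc D)"
      proof -
        have "2 * D \<le> (n - 3) * Suc D" using n by (intro mult_le_mono) auto
        then show ?thesis by (simp add: add_mult_distrib2)
      qed
      ultimately show ?thesis
        using jq star cV cW unfolding D_def[symmetric]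
        by (intro exI[of _ j] exI[of _ "q + Suc D"]) auto
    qed
  qed
qed

section \<open>Graphs that are regular up to parity\<close>

text \<open>
  If no two deficient vertices can simply be joined, then deficient \<open>u\<close>, \<open>v\<close> (possibly equal) admit an
  edge \<open>xy\<close> with \<open>ux\<close> and \<open>vy\<close> absent, and \<open>xy\<close> can be replaced by \<open>ux\<close> and \<open>vy\<close>.
\<close>

lemma exists_larger_bounded_degree:
  assumes fin: "finite V" and gr: "graph_on V P"
    and deg: "\<And>z. card (P `` {z}) \<le> d" and d: "d < card V"
    and room: "card P + 2 \<le> d * card V"
  shows "\<exists>P'. graph_on V P' \<and> (\<forall>z. card (P' `` {z}) \<le> d) \<and> card P' = card P + 2"
proof -
  have sub: "P \<subseteq> V \<times> V" and sy: "sym P" and ir: "irrefl P"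
    using gr by (auto simp: graph_on_def)
  have finP: "finite P" using fin gr by (simp add: finite_graph_on)
  have finN: "finite (P `` {x})" for x using finP by (rule finite_Image)
  have symD: "(b, a) \<in> P" if "(a, b) \<in> P" for a b using sy that by (auto simp: sym_def)
  have irD: "(a, a) \<notin> P" for a using ir by (auto simp: irrefl_def)
  have sumd: "card P = (\<Sum>v\<in>V. card (P `` {v}))" using fin sub by (rule card_eq_sum_degrees)
  show ?thesis
  proof (cases "\<exists>a\<in>V. \<exists>b\<in>V. a \<noteq> b \<and> (a, b) \<notin> P \<and> card (P `` {a}) < d \<and> card (P `` {b}) < d")
    case True
    then obtain a b where ab: "a \<in> V" "b \<in> V" "a \<noteq> b" "(a, b) \<notin> P"
      "card (P `` {a}) < d" "card (P `` {b}) < d" by blast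
    have ba: "(b, a) \<notin> P" using ab symD by blast
    let ?P = "insert (a, b) (insert (b, a) P)"
    have "card (?P `` {z}) \<le> d" for z
    proof -
      consider "z = a" | "z = b" | "z \<noteq> a" "z \<noteq> b" by blast
      then show ?thesis
      proof cases
        case 1
        then have "?P `` {z} = insert b (P `` {a})" using ab by auto
        then show ?thesis using ab finN by (simp add: card_insert_if)
      next
        case 2
        then have "?P `` {z} = insert a (P `` {b})" using ab by auto
        then show ?thesis using ab finN by (simp add: card_insert_if)
      next
        case 3
        then have "?P `` {z} = P `` {z}" by auto
        then show ?thesis using deg by simp
      qed
    qed
    moreover have "graph_on V ?P" using ab gr by (auto simp: graph_on_def sym_def irrefl_def)
    moreover have "card ?P = card P + 2" using ab ba finP by simp
    ultimately show ?thesis by blast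
  next
    case False
    \<comment> \<open>The degrees fall short of \<open>d * card V\<close> by at least 2 in total, so
      there are two distinct deficient vertices or one that lacks 2, which then serves as both
      \<open>u\<close> and \<open>v\<close>.\<close>
    obtain u v where uv: "u \<in> V" "v \<in> V" "card (P `` {u}) < d" "card (P `` {v}) < d"
      "u = v \<Longrightarrow> card (P `` {u}) + 2 \<le> d"
    proof -
      have "\<exists>u\<in>V. card (P `` {u}) < d"
      proof (rule ccontr)
        assume "\<not> ?thesis"
        then have "(\<Sum>v\<in>V. d) \<le> card P" unfolding sumd by (intro sum_mono) (auto simp: not_less)
        then show False using room by (simp add: mult.commute)
      qed
      then obtain u where u: "u \<in> V" "card (P `` {u}) < d" by blast
      show ?thesis
      proof (cases "card (P `` {u}) + 2 \<le> d")
        case True then show ?thesis using u that by blast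
      next
        case F: False
        have "\<exists>v\<in>V - {u}. card (P `` {v}) < d"
        proof (rule ccontr)
          assume "\<not> ?thesis"
          then have "(\<Sum>v\<in>V - {u}. d) \<le> (\<Sum>v\<in>V - {u}. card (P `` {v}))"
            by (intro sum_mono) (auto simp: not_less)
          moreover have "card P = card (P `` {u}) + (\<Sum>v\<in>V - {u}. card (P `` {v}))"
            using sumd fin u by (simp add: sum.remove)
          moreover have "d * card V = d + (\<Sum>v\<in>V - {u}. d)"
            using sum.remove[OF fin u(1), of "\<lambda>_. d"] by (simp add: mult.commute)
          ultimately show False using room F by linarith
        qed
        then show ?thesis using u that by blast
      qed
    qed
    have "\<not> V \<subseteq> insert u (P `` {u})"
    proof
      assume "V \<subseteq> insert u (P `` {u})"
      then have "card V \<le> card (insert u (P `` {u}))" using finN by (intro card_mono) auto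
      also have "\<dots> \<le> Suc (card (P `` {u}))" using finN by (simp add: card_insert_if)
      finally show False using uv d by simp
    qed
    then obtain x where x: "x \<in> V" "x \<noteq> u" "(u, x) \<notin> P" by blast
    \<comment> \<open>\<open>x\<close> is saturated, since otherwise \<open>u\<close> and
      \<open>x\<close> could be joined.\<close>
    have degx: "card (P `` {x}) \<ge> d" using False x uv by (metis not_less)
    have xv: "x \<noteq> v" using degx uv by auto
    have ux: "(x, u) \<notin> P" using x symD by blast
    \<comment> \<open>If \<open>u\<close> and \<open>v\<close> differ, they are adjacent because
      they cannot be joined, so deleting \<open>u\<close> compensates for inserting
      \<open>v\<close>. The set is thus smaller than the neighbourhood of \<open>x\<close>, which
      yields \<open>y\<close>.\<close>
    have "card (insert v (P `` {v}) - {u}) \<le> card (P `` {v})"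
    proof (cases "u = v")
      case True
      then have "insert v (P `` {v}) - {u} = P `` {v}" using irD by auto
      then show ?thesis by simp
    next
      case uv': False
      then have "(v, u) \<in> P" using False uv by metis
      then show ?thesis using finN irD by (simp add: card_Diff_singleton)
    qed
    then have "\<not> P `` {x} \<subseteq> insert v (P `` {v}) - {u}"
      using degx uv finN card_mono[of "insert v (P `` {v}) - {u}" "P `` {x}"] by auto
    then obtain y where y: "(x, y) \<in> P" "y \<noteq> u" "y \<noteq> v" "(v, y) \<notin> P" using ux by blast
    have yx: "(y, x) \<in> P" "y \<noteq> x" and yv: "(y, v) \<notin> P" using y symD irD by blast+
    \<comment> \<open>\<open>x\<close> and \<open>y\<close> exchange one neighbour for another,
      while \<open>u\<close> and \<open>v\<close> gain one each, or two if they coincide.\<close>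
    let ?P = "(P - {(x, y), (y, x)}) \<union> {(u, x), (x, u), (v, y), (y, v)}"
    have "card (?P `` {z}) \<le> d" for z
    proof -
      consider "z = x" | "z = y" | "z = u" "u = v" | "z = u" "u \<noteq> v" | "z = v" "u \<noteq> v"
        | "z \<notin> {x, y, u, v}" by blast
      then show ?thesis
      proof cases
        case 1
        then have "?P `` {z} = insert u (P `` {x} - {y})" using x y yx xv by auto
        moreover have "card (P `` {x}) > 0" using y finN by (auto simp: card_gt_0_iff)
        ultimately show ?thesis using y deg[of x] finN[of x] ux
          by (simp add: card_insert_if card_Diff_singleton)
      next
        case 2
        then have "?P `` {z} = insert v (P `` {y} - {x})" using x y yx xv by auto
        moreover have "card (P `` {y}) > 0" using yx finN by (auto simp: card_gt_0_iff)
        ultimately show ?thesis using yx deg[of y] finN[of y] yv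
          by (simp add: card_insert_if card_Diff_singleton)
      next
        case 3
        then have "?P `` {z} = insert x (insert y (P `` {u}))" using x y yx xv by auto
        then show ?thesis using uv(5)[OF 3(2)] finN[of u] by (simp add: card_insert_if)
      next
        case 4
        then have "?P `` {z} = insert x (P `` {u})" using x y yx xv by auto
        then show ?thesis using uv finN[of u] by (simp add: card_insert_if)
      next
        case 5
        then have "?P `` {z} = insert y (P `` {v})" using x y yx xv by auto
        then show ?thesis using uv finN[of v] by (simp add: card_insert_if)
      next
        case 6
        then have "?P `` {z} = P `` {z}" by auto
        then show ?thesis using deg by simp
      qed
    qed
    moreover have "graph_on V ?P" using uv x y yx xv sub sy ir
      by (auto simp: graph_on_def sym_def irrefl_def)
    moreover have "card ?P = card P + 2"
    proof -
      have "card (P - {(x, y), (y, x)}) = card P - 2"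
        using y yx finP by (subst card_Diff_subset) auto
      moreover have "card P \<ge> 2" using card_mono[OF finP, of "{(x, y), (y, x)}"] y yx by auto
      moreover have "card {(u, x), (x, u), (v, y), (y, v)} = 4" using x y yx xv by auto
      moreover have "card ?P = card (P - {(x, y), (y, x)}) + card {(u, x), (x, u), (v, y), (y, v)}"
        using finP x ux y yv by (intro card_Un_disjoint) auto
      ultimately show ?thesis by simp
    qed
    ultimately show ?thesis by blast
  qed
qed

text \<open>Edges are added one at a time to the empty graph; there is room for each because
  \<open>2 * e\<close> stays within \<open>d * card V\<close>. The largest admissible
  \<open>e\<close> gives a graph that is \<open>d\<close>-regular up to parity.\<close>

lemma exists_bounded_degree:
  assumes "finite V" "d < card V" "2 * e \<le> d * card V"
  shows "\<exists>P. graph_on V P \<and> (\<forall>z. card (P `` {z}) \<le> d) \<and> card P = 2 * e"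
  using assms(3)
proof (induction e)
  case 0
  then show ?case by (intro exI[of _ "{}"]) (auto simp: graph_on_def sym_def irrefl_def)
next
  case (Suc e)
  then obtain P where "graph_on V P" "\<And>z. card (P `` {z}) \<le> d" "card P = 2 * e" by auto
  then show ?case using exists_larger_bounded_degree[of V P d] assms(1,2) Suc.prems by auto
qed

section \<open>Adding disjoint complete components\<close>

text \<open>A copy of $T_n$ is connected, so it would lie inside \<open>V\<close> or inside
  \<open>W\<close>, and \<open>W\<close> has only \<open>n - 1\<close> vertices.\<close>

lemma T_free_add_clique:
  assumes "finite V" "finite W" "V \<inter> W = {}" "card W = n - 1" "n \<ge> 5"
    and "graph_on V P" "T_free n P"
  defines "P' \<equiv> P \<union> (W \<times> W - Id)"
  shows "graph_on (V \<union> W) P'" "T_free n P'" "card P' = card P + (n - 1) * (n - 2)"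
proof -
  show "graph_on (V \<union> W) P'" using assms(6) by (auto simp: graph_on_def P'_def sym_def irrefl_def)
  have sub: "P \<subseteq> V \<times> V" using assms(6) by (simp add: graph_on_def)
  show "T_free n P'"
    unfolding T_free_def
  proof (intro allI impI)
    fix v u w assume *: "(v, u) \<in> P'" "(u, w) \<in> P'" "w \<noteq> v"
    show "card (P' `` {v} - {u, w}) < n - 3"
    proof (cases "v \<in> W")
      case True
      then have "u \<in> W" "w \<in> W" "u \<noteq> v" "w \<noteq> u" using * sub assms(3) by (auto simp: P'_def)
      moreover have "P' `` {v} - {u, w} = W - {v, u, w}"
        using True sub assms(3) by (auto simp: P'_def)
      \<comment> \<open>\<open>v\<close>, \<open>u\<close>, \<open>w\<close> use up three of the
        \<open>n - 1\<close> clique vertices, so \<open>n - 4\<close> leaves remain, one too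
        few.\<close>
      ultimately have "card (P' `` {v} - {u, w}) = n - 1 - 3"
        using True * assms(2,4) by (simp add: card_Diff_subset)
      then show ?thesis using assms(5) by simp
    next
      case False
      then have "P' `` {v} = P `` {v}" "(v, u) \<in> P" "(u, w) \<in> P"
        using * sub assms(3) by (auto simp: P'_def)
      then show ?thesis using assms(7) * unfolding T_free_def by auto
    qed
  qed
  have "card P' = card P + card (W \<times> W - Id)"
    unfolding P'_def using assms sub finite_graph_on by (intro card_Un_disjoint) auto
  then show "card P' = card P + (n - 1) * (n - 2)"
    using card_off_diagonal[OF assms(2)] assms(4) by (simp add: numeral_2_eq_2)
qed

lemma T_free_add_cliques:
  assumes "graph_on {0..<m} P" "T_free n P" "n \<ge> 5"
  shows "\<exists>P'. graph_on {0..<m + j * (n - 1)} P' \<and> T_free n P' \<and>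
    card P' = card P + j * ((n - 1) * (n - 2))"
proof (induction j)
  case 0
  show ?case using assms by auto
next
  case (Suc j)
  then obtain Q where Q: "graph_on {0..<m + j * (n - 1)} Q" "T_free n Q"
    "card Q = card P + j * ((n - 1) * (n - 2))" by blast
  let ?W = "{m + j * (n - 1)..<m + Suc j * (n - 1)}"
  have "{0..<m + j * (n - 1)} \<union> ?W = {0..<m + Suc j * (n - 1)}" by auto
  moreover have "card ?W = n - 1" by simp
  ultimately show ?case
    using T_free_add_clique[of "{0..<m + j * (n - 1)}" ?W n Q] Q assms(3)
    by (intro exI[of _ "Q \<union> (?W \<times> ?W - Id)"]) (auto simp: Int_def)
qed


section \<open>Translation to pair graphs and identification of $T_n$\<close>

lemma pair_graph_iff_graph_on:
  "pair_graph G \<longleftrightarrow> finite (pverts G) \<and> graph_on (pverts G) (parcs G)"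
proof
  assume "pair_graph G"
  then interpret pair_graph G .
  have "sym (parcs G)" using pair_sym_arcs by (simp add: symmetric_def)
  then show "finite (pverts G) \<and> graph_on (pverts G) (parcs G)"
    using pair_finite_verts in_arcsD1 in_arcsD2 pair_no_loops[of "(x, x)" for x]
    unfolding graph_on_def irrefl_def by auto
next
  assume *: "finite (pverts G) \<and> graph_on (pverts G) (parcs G)"
  then have "finite (parcs G)" using finite_graph_on by blast
  moreover have "symmetric (with_proj G)" using * by (simp add: symmetric_def graph_on_def)
  moreover have "fst e \<in> pverts G" "snd e \<in> pverts G" "fst e \<noteq> snd e" if "e \<in> parcs G" for e
    using * that by (cases e; auto simp: graph_on_def irrefl_def)+
  ultimately show "pair_graph G" using * by unfold_locales auto
qed

lemma card_parcs_eq_twice_card_edges: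
  assumes "pair_graph G"
  shows "card (parcs G) = 2 * card (edges G)"
proof -
  have gr: "finite (pverts G)" "graph_on (pverts G) (parcs G)"
    using assms by (simp_all add: pair_graph_iff_graph_on)
  then have fin: "finite (parcs G)" by (simp add: finite_graph_on)
  have E: "edges G = (\<lambda>(u, v). {u, v}) ` parcs G" by (force simp: edges_def)
  have "card (parcs G) = (\<Sum>e\<in>edges G. card {a \<in> parcs G. (\<lambda>(u, v). {u, v}) a = e})"
    using sum.group[of "parcs G" "edges G" "\<lambda>(u, v). {u, v}" "\<lambda>_. 1 :: nat"] fin E by simp
  also have "\<dots> = (\<Sum>e\<in>edges G. 2)"
  proof (rule sum.cong)
    fix e assume "e \<in> edges G"
    then obtain u v where uv: "e = {u, v}" "(u, v) \<in> parcs G" by (auto simp: edges_def)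
    then have "(v, u) \<in> parcs G" "u \<noteq> v"
      using gr by (auto simp: graph_on_def sym_def irrefl_def)
    then have "{a \<in> parcs G. (\<lambda>(u, v). {u, v}) a = e} = {(u, v), (v, u)}"
      using uv by (auto simp: doubleton_eq_iff)
    then show "card {a \<in> parcs G. (\<lambda>(u, v). {u, v}) a = e} = 2" using \<open>u \<noteq> v\<close> by simp
  qed simp
  finally show ?thesis by simp
qed

text \<open>Uniqueness of $T_n$: a vertex \<open>c\<close> of degree \<open>n - 2\<close> leaves a
  single vertex \<open>b\<close> outside its closed neighbourhood. Connectivity joins
  \<open>b\<close> to some neighbour \<open>a\<close> of \<open>c\<close>, and any further edge
  would close a cycle of length 3 or 4.\<close>

lemma is_T_structure:
  fixes T :: "'a pair_pre_digraph"
  assumes "is_T n T" "n \<ge> 5"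
  shows "\<exists>c a b L. pverts T = {c, a, b} \<union> L \<and> finite L \<and> card L = n - 3 \<and>
    distinct [c, a, b] \<and> L \<inter> {c, a, b} = {} \<and>
    parcs T = {c} \<times> insert a L \<union> insert a L \<times> {c} \<union> {(a, b), (b, a)}"
proof -
  have pg: "pair_graph T" and conn: "connected (with_proj T)"
    and acyc: "\<And>p. pre_digraph.cycle (with_proj T) p \<Longrightarrow> length p < 3"
    and cardT: "card (pverts T) = n" and md: "max_degree T = n - 2"
    using assms(1) by (auto simp: is_T_def simple_tree_def not_le)
  interpret pair_graph T by (rule pg)
  let ?P = "parcs T"
  have finV: "finite (pverts T)" and gr: "graph_on (pverts T) ?P"
    using pg by (simp_all add: pair_graph_iff_graph_on)
  have finP: "finite ?P" using finV gr by (simp add: finite_graph_on)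
  have sub: "?P \<subseteq> pverts T \<times> pverts T" using gr by (simp add: graph_on_def)
  have sy: "(y, x) \<in> ?P" if "(x, y) \<in> ?P" for x y
    using gr that by (auto simp: graph_on_def sym_def)
  have ir: "(x, x) \<notin> ?P" for x using gr by (auto simp: graph_on_def irrefl_def)
  have "out_degree (with_proj T) x = card (?P `` {x})" for x
  proof -
    have "out_arcs (with_proj T) x = Pair x ` (?P `` {x})" by (auto simp: out_arcs_def)
    then show ?thesis by (simp add: out_degree_def card_image inj_on_def)
  qed
  moreover have "max_degree T \<in> out_degree (with_proj T) ` pverts T"
    unfolding max_degree_def using finV cardT assms(2) by (intro Max_in) auto
  ultimately obtain c where c: "c \<in> pverts T" "card (?P `` {c}) = n - 2" using md by auto
  define N where "N = ?P `` {c}"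
  have finN: "finite N" using finP by (auto simp: N_def intro: finite_Image)
  have NV: "N \<subseteq> pverts T" "c \<notin> N" using sub ir by (auto simp: N_def)
  have "card (insert c N) = n - 1" using finN NV c assms(2) by (simp add: N_def[symmetric])
  then have "card (pverts T - insert c N) = 1"
    using finN NV c cardT assms(2) by (subst card_Diff_subset) auto
  then obtain b where b: "pverts T - insert c N = {b}" by (meson card_1_singletonE)
  have bV: "b \<in> pverts T" "b \<noteq> c" "b \<notin> N" using b by auto
  have VN: "pverts T = insert b (insert c N)" using b NV c by auto
  have "b \<rightarrow>\<^sup>*\<^bsub>with_proj (mk_symmetric (with_proj T))\<^esub> c"
    using conn bV c unfolding connected_def strongly_connected_def by (simp add: mk_symmetric_def)
  then have "b \<rightarrow>\<^sup>*\<^bsub>with_proj T\<^esub> c"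
    using reachable_mk_symmetric_eq[OF pair_sym_arcs] by simp
  then obtain a where a: "(b, a) \<in> ?P"
    using bV by (cases rule: pre_digraph.converse_reachable_cases) auto
  have aN: "a \<in> N" using a sub VN bV ir sy by (auto simp: N_def)
  have no3: False if "(x, y) \<in> ?P" "(y, z) \<in> ?P" "(z, x) \<in> ?P" for x y z
  proof -
    have "distinct [y, z, x]" using that ir by auto
    then have "cycle [(x, y), (y, z), (z, x)]"
      using that sub by (auto simp: cycle_def awalk_def)
    then show False using acyc by force
  qed
  have no4: False
    if "(x, y) \<in> ?P" "(y, z) \<in> ?P" "(z, w) \<in> ?P" "(w, x) \<in> ?P" "x \<noteq> z" "y \<noteq> w" for x y z w
  proof -
    have "distinct [y, z, w, x]" using that ir by auto
    then have "cycle [(x, y), (y, z), (z, w), (w, x)]"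
      using that sub by (auto simp: cycle_def awalk_def)
    then show False using acyc by force
  qed
  have NN: "(x, y) \<notin> ?P" if "x \<in> N" "y \<in> N" for x y
    using no3[of c x y] that sy by (auto simp: N_def)
  have bx: "x = a" if "(b, x) \<in> ?P" for x
  proof (rule ccontr)
    assume "x \<noteq> a"
    have "x \<in> N" using that sub VN bV ir sy by (auto simp: N_def)
    then show False using no4[of c a b x] a aN \<open>x \<noteq> a\<close> that sy bV by (auto simp: N_def)
  qed
  define L where "L = N - {a}"
  have N: "N = insert a L" using aN by (auto simp: L_def)
  have "?P = {c} \<times> N \<union> N \<times> {c} \<union> {(a, b), (b, a)}"
  proof (intro equalityI subsetI)
    fix e assume e: "e \<in> ?P"
    then obtain x y where xy: "e = (x, y)" "(x, y) \<in> ?P" by (cases e) auto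
    then have "x \<in> insert b (insert c N)" "y \<in> insert b (insert c N)" using sub VN by blast+
    then show "e \<in> {c} \<times> N \<union> N \<times> {c} \<union> {(a, b), (b, a)}"
      using xy NN[of x y] bx[of x] bx[of y] sy[of x y] ir[of c] unfolding N_def by auto
  qed (use a sy in \<open>auto simp: N_def\<close>)
  then have "?P = {c} \<times> insert a L \<union> insert a L \<times> {c} \<union> {(a, b), (b, a)}"
    by (simp only: N)
  moreover have "finite L" using finN by (simp add: L_def)
  moreover have "card L = n - 3" using finN aN c by (simp add: L_def N_def)
  moreover have "pverts T = {c, a, b} \<union> L" using VN N by auto
  moreover have "distinct [c, a, b]" "L \<inter> {c, a, b} = {}"
    using bV NV aN by (auto simp: L_def)
  ultimately show ?thesis by blast
qed

text \<open>The images of \<open>c\<close>, \<open>a\<close>, \<open>b\<close> are the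
  \<open>v\<close>, \<open>u\<close>, \<open>w\<close> of \<open>T_free\<close>, and
  \<open>L\<close> fits exactly when \<open>v\<close> has at least \<open>n - 3\<close> neighbours
  other than \<open>u\<close> and \<open>w\<close>.\<close>

lemma contains_T_iff:
  assumes T: "is_T n T" "n \<ge> 5" and G: "pair_graph G"
  shows "contains_subgraph G T \<longleftrightarrow> \<not> T_free n (parcs G)"
proof -
  obtain c a b L where V: "pverts T = {c, a, b} \<union> L" and L: "finite L" "card L = n - 3"
    "distinct [c, a, b]" "L \<inter> {c, a, b} = {}"
    and P: "parcs T = {c} \<times> insert a L \<union> insert a L \<times> {c} \<union> {(a, b), (b, a)}"
    using is_T_structure[OF T] by blast
  have gr: "finite (pverts G)" "graph_on (pverts G) (parcs G)"
    using G by (simp_all add: pair_graph_iff_graph_on)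
  have finP: "finite (parcs G)" using gr by (simp add: finite_graph_on)
  have wfT: "wf_digraph (with_proj T)" using T unfolding is_T_def simple_tree_def
    by (simp add: pair_graph_def pair_digraph_def pair_fin_digraph_def wf_digraph_wp_iff)
  have wfG: "wf_digraph (with_proj G)" using G
    by (simp add: pair_graph_def pair_digraph_def pair_fin_digraph_def wf_digraph_wp_iff)
  show ?thesis
  proof
    assume "contains_subgraph G T"
    then obtain H h where H: "subgraph H (with_proj G)" "H = app_iso h (with_proj T)"
      and h: "pre_digraph.digraph_isomorphism (with_proj T) h"
      by (auto simp: contains_subgraph_def digraph_iso_def)
    define f where "f = iso_verts h"
    have inj: "inj_on f (pverts T)" using h by (simp add: pre_digraph.digraph_isomorphism_def f_def)
    \<comment> \<open>Compatibility with \<open>G\<close> forces the relabelled copy of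
      \<open>T\<close> to use the ordinary tail and head functions, so the arc map acts as
      \<open>f\<close> on endpoints.\<close>
    have tl: "iso_tail h = fst" "iso_head h = snd"
      using H by (auto simp: subgraph_def compatible_def app_iso_def)
    have arc: "(f x, f y) \<in> parcs G" if "(x, y) \<in> parcs T" for x y
    proof -
      have "iso_arcs h (x, y) \<in> parcs G" using H that by (auto simp: subgraph_def app_iso_def)
      moreover have "f x = fst (iso_arcs h (x, y))" "f y = snd (iso_arcs h (x, y))"
        using h that tl by (auto simp: pre_digraph.digraph_isomorphism_def f_def)
      ultimately show ?thesis by simp
    qed
    have "f ` L \<subseteq> parcs G `` {f c} - {f a, f b}"
    proof
      fix y assume "y \<in> f ` L"
      then obtain x where x: "x \<in> L" "y = f x" by blast
      have "x \<noteq> a" "x \<noteq> b" using x L by auto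
      then have "y \<noteq> f a" "y \<noteq> f b" using x V inj_on_eq_iff[OF inj] by auto
      moreover have "(f c, y) \<in> parcs G" using arc[of c x] x P by simp
      ultimately show "y \<in> parcs G `` {f c} - {f a, f b}" by simp
    qed
    then have "card (f ` L) \<le> card (parcs G `` {f c} - {f a, f b})"
      using finP by (intro card_mono) (auto intro: finite_Image)
    moreover have "card (f ` L) = n - 3" 
    proof -
      have "inj_on f L" using V by (intro inj_on_subset[OF inj]) blast
      then show ?thesis using L by (simp add: card_image)
    qed
    moreover have "(f c, f a) \<in> parcs G" "(f a, f b) \<in> parcs G" using arc P by auto
    moreover have "f b \<noteq> f c" using inj_on_eq_iff[OF inj, of b c] V L by auto
    ultimately show "\<not> T_free n (parcs G)" unfolding T_free_def by (metis not_le)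
  next
    assume "\<not> T_free n (parcs G)"
    then obtain v u w where vuw: "(v, u) \<in> parcs G" "(u, w) \<in> parcs G" "w \<noteq> v"
      "card (parcs G `` {v} - {u, w}) \<ge> n - 3" by (auto simp: T_free_def not_less)
    \<comment> \<open>\<open>S\<close> receives the leaves \<open>L\<close>; it is cut down to
      exactly \<open>n - 3\<close> vertices so that a bijection exists.\<close>
    then obtain S where S: "S \<subseteq> parcs G `` {v} - {u, w}" "card S = n - 3" "finite S"
      by (meson obtain_subset_with_card_n)
    obtain g where g: "bij_betw g L S"
      using finite_same_card_bij[OF L(1) S(3)] L(2) S(2) by auto
    have gS: "g x \<in> S" if "x \<in> L" for x using g that by (auto simp: bij_betw_def)
    define f where "f = (\<lambda>x. if x = c then v else if x = a then u else if x = b then w else g x)"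
    have fL: "f x = g x" if "x \<in> L" for x using that L by (auto simp: f_def)
    have fcab: "f c = v" "f a = u" "f b = w" using L by (auto simp: f_def)
    have sy: "(y, x) \<in> parcs G" if "(x, y) \<in> parcs G" for x y
      using gr that by (auto simp: graph_on_def sym_def)
    have ir: "(x, x) \<notin> parcs G" for x using gr by (auto simp: graph_on_def irrefl_def)
    have Sn: "v \<notin> S" "u \<notin> S" "w \<notin> S" using S ir by auto
    have "inj_on f L" using bij_betw_imp_inj_on[OF g] inj_on_cong[of L f g] fL by blast
    moreover have "inj_on f {c, a, b}" using L vuw ir by (auto simp: inj_on_def fcab)
    moreover have "f ` {c, a, b} \<inter> f ` L = {}" using Sn fL gS fcab by fastforce
    ultimately have inj: "inj_on f (pverts T)" unfolding V
      by (simp add: inj_on_Un) blast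
    have arc: "(f x, f y) \<in> parcs G" if "(x, y) \<in> parcs T" for x y
    proof -
      have "(v, f z) \<in> parcs G" if z: "z \<in> insert a L" for z
      proof (cases "z = a")
        case False
        then have "f z \<in> S" using z gS fL by simp
        then show ?thesis using S(1) by blast
      qed (use vuw fcab in simp)
      then show ?thesis using that sy vuw(2) fcab unfolding P by blast
    qed
    define h where "h = \<lparr>iso_verts = f, iso_arcs = map_prod f f, iso_head = snd, iso_tail = fst\<rparr>"
    have arcsT: "fst e \<in> pverts T" "snd e \<in> pverts T" if "e \<in> parcs T" for e
      using wfT that by (cases e; auto simp: wf_digraph_def)+
    have "inj_on (map_prod f f) (parcs T)"
    proof (rule inj_on_subset)
      show "inj_on (map_prod f f) (pverts T \<times> pverts T)" using inj by (simp add: map_prod_inj_on)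
      show "parcs T \<subseteq> pverts T \<times> pverts T" using arcsT by force
    qed
    then have "pre_digraph.digraph_isomorphism (with_proj T) h"
      using wfT inj by (simp add: pre_digraph.digraph_isomorphism_def h_def)
    moreover have "subgraph (app_iso h (with_proj T)) (with_proj G)"
    proof -
      have "f x \<in> pverts G" if x: "x \<in> pverts T" for x
      proof -
        \<comment> \<open>\<open>T\<close> has no isolated vertex, so its vertices are mapped into
          \<open>G\<close> because its arcs are.\<close>
        have "\<exists>y. (x, y) \<in> parcs T" using x V P by auto
        then show ?thesis using arc gr by (force simp: graph_on_def)
      qed
      moreover have "wf_digraph (app_iso h (with_proj T))"
        using arcsT by unfold_locales (auto simp: app_iso_def h_def)
      ultimately show ?thesis using arc wfG
        by (auto simp: subgraph_def compatible_def app_iso_def h_def)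
    qed
    ultimately show "contains_subgraph G T" by (auto simp: contains_subgraph_def digraph_iso_def)
  qed
qed

text \<open>Arc counts are even, so the slack of 1 above \<open>2 * M\<close> costs nothing and
  absorbs the rounding in the extremal number.\<close>

lemma ex_T_eqI:
  assumes T: "is_T n T" "n \<ge> 5"
    and upper: "\<And>(V :: nat set) P. \<lbrakk>finite V; card V = p; graph_on V P; T_free n P\<rbrakk> \<Longrightarrow> card P \<le> 2 * M + 1"
    and lower: "graph_on {0..<p} P" "T_free n P" "card P = 2 * M"
  shows "ex p T = M"
proof -
  let ?A = "{card (edges G) | G :: nat pair_pre_digraph.
     pair_graph G \<and> card (pverts G) = p \<and> \<not> contains_subgraph G T}"
  have le: "m \<le> M" if m: "m \<in> ?A" for m
  proof -
    obtain G :: "nat pair_pre_digraph" where G: "m = card (edges G)" "pair_graph G"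
      "card (pverts G) = p" "\<not> contains_subgraph G T" using m by blast
    then have "card (parcs G) \<le> 2 * M + 1"
      using contains_T_iff[OF T G(2)] upper pair_graph_iff_graph_on by blast
    then show ?thesis using card_parcs_eq_twice_card_edges G by force
  qed
  let ?G = "\<lparr>pverts = {0..<p}, parcs = P\<rparr>"
  have "pair_graph ?G" using lower by (simp add: pair_graph_iff_graph_on)
  moreover from this have "card (edges ?G) = M"
    using card_parcs_eq_twice_card_edges[of ?G] lower by simp
  moreover have "\<not> contains_subgraph ?G T"
    using contains_T_iff[OF T \<open>pair_graph ?G\<close>] lower by simp
  ultimately have "M \<in> ?A" by (intro CollectI exI[of _ ?G]) simp
  moreover have "finite ?A" using le by (meson atMost_iff finite_atMost finite_subset subsetI)
  ultimately show ?thesis unfolding ex_def using le by (intro Max_eqI) auto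
qed

section \<open>Comparison of the two candidate values\<close>

text \<open>Here \<open>s\<close> stands for \<open>n - 3\<close>. If \<open>j = Suc k\<close> then
  \<open>q = r\<close> and the bound with \<open>q * (q - 1)\<close> applies. Otherwise
  \<open>j\<close> is at most \<open>k\<close>, and each block of \<open>s + 2\<close> vertices
  exceeds the count for average degree \<open>s\<close> by at most \<open>s + 2\<close>
  arcs.\<close>

lemma T_free_card_le_max:
  assumes V: "finite V" "graph_on V P" "T_free (s + 3) P" "s \<ge> 2"
    and card: "card V = Suc k * (s + 2) + r" and r: "r \<le> s + 1"
  shows "card P \<le> max (Suc k * ((s + 2) * (s + 1)) + r * (r - 1))
    (s * card V + k * (s + 2))"
proof -
  obtain j q where jq: "card V = j * (s + 2) + q"
    "card P \<le> j * ((s + 2) * (s + 1)) + q * (q - 1)"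
    "card P \<le> j * ((s + 2) * (s + 1)) + s * q"
    using T_free_card_bound[OF V(1-3)] V(4) by (auto simp: eval_nat_numeral)
  have "j \<le> Suc k"
  proof (rule ccontr)
    assume "\<not> ?thesis"
    then have "Suc (Suc k) * (s + 2) \<le> j * (s + 2)" by (intro mult_le_mono1) simp
    then show False using card jq(1) r by simp
  qed
  then consider "j = Suc k" | "j \<le> k" by linarith
  then show ?thesis
  proof cases
    case 1
    then have "q = r" using card jq(1) by simp
    then show ?thesis using jq(2) 1 by simp
  next
    case 2
    have "card P \<le> s * card V + j * (s + 2)" using jq(3) unfolding jq(1) by (simp add: algebra_simps)
    also have "\<dots> \<le> s * card V + k * (s + 2)" using mult_le_mono1[OF 2] by (rule add_left_mono)
    finally show ?thesis by simp
  qed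
qed

theorem theorem3p1:
  fixes p n r :: nat and T :: "'a pair_pre_digraph"
  assumes "n \<ge> 5" and "p \<ge> n"
    and "r \<in> {0..n - 2}" and "[p = r] (mod (n - 1))"
    and "is_T n T"
  shows "real (ex p T) =
    (if n \<ge> 7 \<and> 2 \<le> r \<and> r \<le> n - 4
     then real_of_int \<lfloor>((real n - 2) * (real p - 1) - real r - 1) / 2\<rfloor>
     else ((real n - 2) * real p - real r * (real n - 1 - real r)) / 2)"
proof -
  obtain s where s: "n = s + 3" "s \<ge> 2" using assms(1) by (intro that[of "n - 3"]) auto
  have r: "r \<le> s + 1" using assms(3) s by simp
  have "p mod (s + 2) = r" using assms(4) s r by (simp add: cong_def)
  then have pk: "p = (p div (s + 2)) * (s + 2) + r" using div_mult_mod_eq[of p "s + 2"] by simp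
  have "p div (s + 2) > 0" using assms(2) s by (simp add: div_greater_zero_iff)
  then obtain k where p: "p = Suc k * (s + 2) + r" using pk by (metis Suc_pred)
  \<comment> \<open>\<open>A\<close> is twice the number of edges of \<open>Suc k\<close> copies of
    $K_{n-1}$ together with $K_r$; \<open>B\<close> is the bound for at most \<open>k\<close> such
    blocks.\<close>
  define A where "A = Suc k * ((s + 2) * (s + 1)) + r * (r - 1)"
  define B where "B = s * p + k * (s + 2)"
  have upper: "card P \<le> max A B"
    if "finite V" "card V = p" "graph_on V P" "T_free n P" for V :: "nat set" and P
    using T_free_card_le_max[of V P s k r] that s r p unfolding A_def B_def by simp
  \<comment> \<open>This form shows the graph behind \<open>B\<close>: \<open>k\<close> cliques and
    \<open>s + 2 + r\<close> vertices of degree \<open>s\<close>, up to parity.\<close>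
  have B_alt: "B = s * (s + 2 + r) + k * ((s + 2) * (s + 1))" unfolding B_def p by (simp add: algebra_simps)
  have AB: "real A = (real n - 2) * real p - real r * (real n - 1 - real r)"
    "real B = (real n - 2) * (real p - 1) - real r - 1"
  proof -
    have "real (r * (r - 1)) = real r * (real r - 1)" by (cases r) (auto simp: algebra_simps)
    then have "real A = real (Suc k * ((s + 2) * (s + 1))) + real r * (real r - 1)"
      by (simp only: A_def of_nat_add)
    then show "real A = (real n - 2) * real p - real r * (real n - 1 - real r)"
      unfolding p s(1) by (simp add: algebra_simps)
    show "real B = (real n - 2) * (real p - 1) - real r - 1"
      unfolding B_def p s(1) by (simp add: algebra_simps)
  qed
  \<comment> \<open>Hence \<open>A \<le> B\<close> exactly when
    \<open>s + 2 + r * (r - 1) \<le> s * r\<close>.\<close>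
  have diff: "A + s * r = B + (s + 2 + r * (r - 1))"
  proof -
    define c where "c = r * (r - 1)"
    show ?thesis unfolding A_def B_alt c_def[symmetric] by (simp add: algebra_simps)
  qed
  have ev: "even ((s + 2) * (s + 1))" "even (r * (r - 1))" by auto
  show ?thesis
  proof (cases "n \<ge> 7 \<and> 2 \<le> r \<and> r \<le> n - 4")
    case True
    then have rs: "s \<ge> 4" "2 \<le> r" "r + 1 \<le> s" using s by auto
    have "s + 2 + r * (r - 1) \<le> s * r"
    proof -
      \<comment> \<open>The claim becomes \<open>2 \<le> (1 + t) * (i + 1)\<close>, which fails only
        for \<open>i = t = 0\<close>, that is \<open>s = 3\<close>, excluded by
        \<open>n \<ge> 7\<close>.\<close>
      obtain i t where i: "r = i + 2" and t: "s = i + 3 + t"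
      proof
        show "r = (r - 2) + 2" "s = (r - 2) + 3 + (s - r - 1)" using rs by auto
      qed
      have "2 \<le> (1 + t) * (i + 1)" using rs(1) t by (cases i; cases t) auto
      then show ?thesis unfolding i t by (simp add: algebra_simps)
    qed
    then have "A \<le> B" using diff by linarith
    \<comment> \<open>\<open>m\<close> vertices are left beside \<open>k\<close> cliques, and
      \<open>e\<close> is the largest number of edges on them with all degrees at most
      \<open>s\<close>.\<close>
    define m where "m = s + 2 + r"
    define e where "e = s * m div 2"
    have "\<exists>P. graph_on {0..<m} P \<and> (\<forall>z. card (P `` {z}) \<le> s) \<and> card P = 2 * e"
      by (rule exists_bounded_degree) (auto simp: m_def e_def)
    then obtain P0 where P0: "graph_on {0..<m} P0" "\<And>z. card (P0 `` {z}) \<le> s" "card P0 = 2 * e"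
      by blast
    have "T_free n P0" using P0 s by (intro T_free_if_degree_le) (auto simp: finite_graph_on)
    then obtain P where P: "graph_on {0..<m + k * (n - 1)} P" "T_free n P"
      "card P = 2 * e + k * ((n - 1) * (n - 2))"
      using T_free_add_cliques[OF P0(1)] P0(3) assms(1) by metis
    have "m + k * (n - 1) = p" by (simp add: m_def p s(1))
    \<comment> \<open>The cliques contribute an even number of arcs, so rounding
      \<open>s * m\<close> down to an even number does the same to \<open>B\<close>.\<close>
    moreover have "card P = 2 * (B div 2)"
    proof -
      have "even (k * ((s + 2) * (s + 1)))" using ev by simp
      then obtain x where x: "k * ((s + 2) * (s + 1)) = 2 * x" by (elim evenE)
      then have "B = s * m + 2 * x" by (simp add: B_alt m_def)
      then have "2 * (B div 2) = 2 * e + 2 * x" by (simp add: e_def)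
      moreover have "(n - 1) * (n - 2) = (s + 2) * (s + 1)" by (simp add: s(1))
      ultimately show ?thesis using P(3) x by simp
    qed
    ultimately have "graph_on {0..<p} P" "card P = 2 * (B div 2)" using P(1) by simp_all
    moreover have "card Q \<le> 2 * (B div 2) + 1"
      if "finite V" "card V = p" "graph_on V Q" "T_free n Q" for V :: "nat set" and Q
    proof -
      have "card Q \<le> B" using upper[OF that] \<open>A \<le> B\<close> by simp
      then show ?thesis by linarith
    qed
    ultimately have "ex p T = B div 2" using P(2) by (intro ex_T_eqI[OF assms(5,1)])
    moreover have "\<lfloor>real B / 2\<rfloor> = int (B div 2)"
      using floor_divide_of_nat_eq[of B 2, where 'a = real] by simp
    ultimately show ?thesis unfolding if_P[OF True] AB(2)[symmetric] by simp
  next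
    case False
    \<comment> \<open>With \<open>2 \<le> r < s\<close> the only remaining possibility is
      \<open>n = 6\<close>, \<open>r = 2\<close>.\<close>
    then consider "r \<le> 1" | "r = s" | "r = s + 1" | "s = 3" "r = 2" using s r by linarith
    then have "s * r \<le> s + 2 + r * (r - 1)"
    proof cases
      case 1
      then have "r = 0 \<or> r = 1" by auto
      then show ?thesis by auto
    next
      case 2
      have "s + s * (s - 1) = s * s" using s(2) by (cases s) auto
      then show ?thesis using 2 by simp
    qed auto
    then have "B \<le> A" using diff by linarith
    have "graph_on {0..<r} ({0..<r} \<times> {0..<r} - Id)"
      by (auto simp: graph_on_def sym_def irrefl_def)
    moreover have "T_free n ({0..<r} \<times> {0..<r} - Id)"
    proof (rule T_free_if_degree_le)
      fix v
      show "card (({0..<r} \<times> {0..<r} - Id) `` {v}) \<le> n - 3"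
      proof (cases "v < r")
        case True
        then have "({0..<r} \<times> {0..<r} - Id) `` {v} = {0..<r} - {v}" by auto
        then show ?thesis using True r s by simp
      next
        case False
        then have "({0..<r} \<times> {0..<r} - Id) `` {v} = {}" by auto
        then show ?thesis by simp
      qed
    qed (use assms in auto)
    ultimately obtain P where P: "graph_on {0..<r + Suc k * (n - 1)} P" "T_free n P"
      "card P = card ({0..<r} \<times> {0..<r} - Id) + Suc k * ((n - 1) * (n - 2))"
      using T_free_add_cliques assms(1) by blast
    have "r + Suc k * (n - 1) = p" by (simp add: p s(1))
    moreover have "card P = A"
      using P(3) card_off_diagonal[of "{0..<r}"] by (simp add: A_def s(1))
    \<comment> \<open>\<open>A\<close> is even, so no rounding occurs in this case.\<close>
    moreover have "even A" using ev by (simp add: A_def)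
    ultimately have "graph_on {0..<p} P" "card P = 2 * (A div 2)" using P(1) by simp_all
    moreover have "card Q \<le> 2 * (A div 2) + 1"
      if "finite V" "card V = p" "graph_on V Q" "T_free n Q" for V :: "nat set" and Q
    proof -
      have "card Q \<le> A" using upper[OF that] \<open>B \<le> A\<close> by simp
      then show ?thesis by linarith
    qed
    ultimately have "ex p T = A div 2" using P(2) by (intro ex_T_eqI[OF assms(5,1)])
    then have "real (ex p T) = real A / 2" using \<open>even A\<close> by (simp add: real_of_nat_div)
    then show ?thesis unfolding if_not_P[OF False] AB(1) .
  qed
qed

end
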